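(* Let $l\subseteq\mathbb{R}^d$ be a line, let $L\colon\mathbb{R}^d\to\mathbb{R}$ be an affine functional, let $x\in\widetilde{E}(L,l)$, and let $y\in\partial_l E(x,L,l)$, where $\partial_l$ denotes the boundary in the topology of $l$. Suppose that the pair $x,y$ satisfies the following cone condition: there exists $\varepsilon>0$ such that for every point $z\in B_\varepsilon(y)\cap\operatorname{clos}\Omega$ the inclusion $[x,z)\subseteq\operatorname{int}\Omega$ holds. Then $L(y)=\overline{f}(y)$.
   Context: Segments: $[a,b]=\{(1-t)a+tb: 0\le t\le 1\}$, $(a,b)=\{(1-t)a+tb: 0<t<1\}$, $[a,b)=\{(1-t)a+tb:0\le t<1\}$. $B_\varepsilon(y)$ is the closed ball of radius $\varepsilon$ centered at $y$. $\overline{\mathbb{R}}=\mathbb{R}\cup\{-\infty,+\infty\}$. An $\overline{\mathbb{R}}$-valued function $B$ on a convex set is concave if its subgraph $\{(z,t): t\in\mathbb{R},\ t\le B(z)\}$ is convex. A function $B\colon\Omega\to\overline{\mathbb{R}}$ on $\Omega\subseteq\mathbb{R}^d$ is locally concave if its restriction to every segment contained in $\Omega$ is concave. Given $\Omega\subseteq\mathbb{R}^d$ and $f\colon\Omega\to\overline{\mathbb{R}}$, the minimal locally concave function is $\mathcal{B}(x)=\inf\{B(x): B\colon\Omega\to\overline{\mathbb{R}}\text{ locally concave},\ B\ge f\text{ on }\Omega\}$. Standing assumption: $\mathcal{B}$ is finite at every point of $\operatorname{int}\Omega$. Let $\overline{f}(y)=\limsup_{z\in\Omega,\,z\to y}f(z)$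 for $y\in\operatorname{clos}\Omega$ be the upper semicontinuous majorant of $f$ ($z=y$ is allowed if $y\in\Omega$), $E_0=\{x\in\operatorname{int}\Omega:\mathcal{B}(x)=\overline{f}(x)\}$, and $E_{>0}=\operatorname{int}\Omega\setminus E_0$ (an open set). Closure and interior are in $\mathbb{R}^d$. For a closed convex set $W\subseteq E_{>0}$ with nonempty interior and an affine functional $L$ with $\mathcal{B}|_W\le L|_W$ put $U(W,L)=\{x\in W:\mathcal{B}(x)=L(x)\}$ (a closed convex set). A convex subset $F$ of a convex set $U$ is a face of $U$ if for all $y,z\in U$ with $(y,z)\cap F\neq\varnothing$ one has $[y,z]\subseteq F$. The pre-extremal set $\widetilde{E}(L,l)$, for an affine functional $L$ and an affine subspace $l$ of $\mathbb{R}^d$, is the set of points $x\in E_{>0}\cap l$ for which there is a closed convex $W\subseteq E_{>0}$ with nonempty interior such that $x\in\operatorname{int}W$, $\mathcal{B}|_W\le L|_W$, $x\in U(W,L)$, and $l\cap U(W,L)$ is a face of $U(W,L)$ with $\operatorname{aff}(l\cap U(W,L))=l$. For $x\in\widetilde{E}(L,l)$ the extremal set $E(x,L,l)$ is the connected component of $x$ in $\widetilde{E}(L,l)$. *)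

theory Defs
  imports "HOL-Analysis.Analysis"
begin

text \<open>
  Extended-real-valued functions on a set \<open>\<Omega>\<close> are rendered as total functions;
  all notions below depend only on their values on \<open>\<Omega>\<close>.
\<close>

definition affine_functional :: "('a::real_vector \<Rightarrow> real) \<Rightarrow> bool" where
  "affine_functional L \<longleftrightarrow> (\<exists>g c. linear g \<and> (\<forall>z. L z = g z + c))"

definition is_line :: "'a::euclidean_space set \<Rightarrow> bool" where
  "is_line l \<longleftrightarrow> affine l \<and> aff_dim l = 1"

definition right_open_segment :: "'a::real_vector \<Rightarrow> 'a \<Rightarrow> 'a set" where
  "right_open_segment a b = {(1 - t) *\<^sub>R a + t *\<^sub>R b | t. 0 \<le> t \<and> t < 1}"

text \<open>
  The second component of the subgraph is a real number, so concavity is meaningful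
  even for functions that take both values \<open>-\<infinity>\<close> and \<open>\<infinity>\<close>.
\<close>

definition subgraph_on :: "'a set \<Rightarrow> ('a \<Rightarrow> ereal) \<Rightarrow> ('a \<times> real) set" where
  "subgraph_on S B = {(z, t). z \<in> S \<and> ereal t \<le> B z}"

definition ereal_concave_on :: "'a::real_vector set \<Rightarrow> ('a \<Rightarrow> ereal) \<Rightarrow> bool" where
  "ereal_concave_on S B \<longleftrightarrow> convex S \<and> convex (subgraph_on S B)"

definition locally_concave_on :: "'a::real_vector set \<Rightarrow> ('a \<Rightarrow> ereal) \<Rightarrow> bool" where
  "locally_concave_on \<Omega> B \<longleftrightarrow>
     (\<forall>a b. closed_segment a b \<subseteq> \<Omega> \<longrightarrow> ereal_concave_on (closed_segment a b) B)"

definition min_locally_concave ::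
    "'a::real_vector set \<Rightarrow> ('a \<Rightarrow> ereal) \<Rightarrow> 'a \<Rightarrow> ereal" where
  "min_locally_concave \<Omega> f x =
     Inf {B x | B. locally_concave_on \<Omega> B \<and> (\<forall>z\<in>\<Omega>. f z \<le> B z)}"

text \<open>
  The filter below differs from \<open>at y within \<Omega>\<close>: it does not exclude the point \<open>y\<close> itself.
  The definition is meant for \<open>y \<in> closure \<Omega>\<close>; elsewhere the filter is trivial.
\<close>

definition usc_majorant ::
    "'a::topological_space set \<Rightarrow> ('a \<Rightarrow> ereal) \<Rightarrow> 'a \<Rightarrow> ereal" where
  "usc_majorant \<Omega> f y = Limsup (inf (nhds y) (principal \<Omega>)) f"

definition E_zero :: "'a::euclidean_space set \<Rightarrow> ('a \<Rightarrow> ereal) \<Rightarrow> 'a set" where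
  "E_zero \<Omega> f = {x \<in> interior \<Omega>. min_locally_concave \<Omega> f x = usc_majorant \<Omega> f x}"

definition E_pos :: "'a::euclidean_space set \<Rightarrow> ('a \<Rightarrow> ereal) \<Rightarrow> 'a set" where
  "E_pos \<Omega> f = interior \<Omega> - E_zero \<Omega> f"

definition contact_set ::
    "'a::euclidean_space set \<Rightarrow> ('a \<Rightarrow> ereal) \<Rightarrow> 'a set \<Rightarrow> ('a \<Rightarrow> real) \<Rightarrow> 'a set" where
  "contact_set \<Omega> f W L = {x \<in> W. min_locally_concave \<Omega> f x = ereal (L x)}"

text \<open>
  The library's \<open>face_of\<close> speaks about non-degenerate open segments and about the endpoints
  only; for convex subsets this is the same as requiring the whole closed segment to
  lie in the face.
\<close>

definition pre_extremal_set ::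
    "'a::euclidean_space set \<Rightarrow> ('a \<Rightarrow> ereal) \<Rightarrow> ('a \<Rightarrow> real) \<Rightarrow> 'a set \<Rightarrow> 'a set" where
  "pre_extremal_set \<Omega> f L l =
     {x \<in> E_pos \<Omega> f \<inter> l.
        \<exists>W. closed W \<and> convex W \<and> W \<subseteq> E_pos \<Omega> f \<and> interior W \<noteq> {} \<and>
            x \<in> interior W \<and>
            (\<forall>z\<in>W. min_locally_concave \<Omega> f z \<le> ereal (L z)) \<and>
            x \<in> contact_set \<Omega> f W L \<and>
            (l \<inter> contact_set \<Omega> f W L) face_of contact_set \<Omega> f W L \<and>
            affine hull (l \<inter> contact_set \<Omega> f W L) = l}"

definition extremal_set ::
    "'a::euclidean_space set \<Rightarrow> ('a \<Rightarrow> ereal) \<Rightarrow> 'a \<Rightarrow> ('a \<Rightarrow> real) \<Rightarrow> 'a set \<Rightarrow> 'a set" where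
  "extremal_set \<Omega> f x L l = connected_component_set (pre_extremal_set \<Omega> f L l) x"

end

theory Submission
  imports Defs
begin

text \<open>
  Write \<open>B\<close> for the minimal locally concave function. Minimality enters only through the
  following minimum principle: if an affine \<open>M\<close> dominates \<open>f\<close> on \<open>\<Omega> \<inter> cball y r\<close> and dominates
  \<open>B\<close> on \<open>\<Omega> \<inter> sphere y r\<close>, then it dominates \<open>B\<close> on \<open>\<Omega> \<inter> cball y r\<close>, since otherwise
  \<open>min B M\<close> inside the ball would be a smaller locally concave majorant of \<open>f\<close>
  (\<open>min_locally_concave_minimum_principle\<close>).

  Its consequence is that a contact point cannot be extreme. Suppose that \<open>B \<le> L\<close> near \<open>y\<close>, that
  points with \<open>B = L\<close> accumulate at \<open>y\<close> (or \<open>y\<close> is one), and that the upper semicontinuous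
  majorant of \<open>f\<close> is below \<open>L\<close> at \<open>y\<close>. If \<open>y\<close> could be separated by an affine functional \<open>g\<close>,
  with \<open>g y > 0\<close>, from the part of the contact set that stays away from \<open>y\<close>, then
  \<open>L - d * g\<close> with a small \<open>d > 0\<close> would satisfy the minimum principle and force \<open>B\<close> below \<open>L\<close>
  near \<open>y\<close>. Hence \<open>y\<close> lies in the convex hull of the contact points away from it
  (\<open>contact_point_in_convex_hull\<close>). As \<open>y\<close> may lie on the boundary of \<open>\<Omega>\<close>, where \<open>B\<close> need not be
  continuous, the contact set has to be replaced by the closed set of asymptotic contact points.

  This is used twice, each time together with the fact that a convex hull meets a face only in the
  hull of the points that lie on the face (\<open>face_point_not_in_convex_hull\<close>).

  The first use shows that the pre-extremal set is open in the line \<open>l\<close>: an end point of the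
  face \<open>l \<inter> U(W, L)\<close> would have all other contact points of the face on one side
  (\<open>pre_extremal_set_open_in_line\<close>). So \<open>y\<close> is not pre-extremal, whereas the half-open segment
  from \<open>x\<close> to \<open>y\<close> consists of pre-extremal points.

  The second use is at \<open>y\<close> itself. Concavity along the segments from \<open>x\<close>, which the cone
  condition provides, gives \<open>B \<le> L\<close> on \<open>\<Omega>\<close> near \<open>y\<close> (\<open>le_affine_of_contact\<close>), hence
  the inequality \<open>\<ge>\<close> in the claim. Suppose it is strict. For an asymptotic contact point \<open>z\<close> near \<open>y\<close>
  one has \<open>B = L\<close> on the whole half-open segment from \<open>x\<close> to \<open>z\<close>, so the homothety with centre \<open>x\<close> and
  a small ratio carries such points into \<open>U(W, L)\<close>, of which \<open>l \<inter> U(W, L)\<close> is a face.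
  No such point lies on \<open>l\<close> beyond \<open>y\<close>: otherwise \<open>y\<close> would be interior to \<open>\<Omega>\<close>, and the
  homothety would transport the face property back to a ball around \<open>y\<close>, making \<open>y\<close> pre-extremal.
  Therefore the image of \<open>y\<close> has all other image points of the face on one side, and \<open>y\<close> is not in the
  convex hull of the contact points away from it, a contradiction.
\<close>

section \<open>Locally concave functions\<close>

lemma locally_concave_onD:
  assumes "locally_concave_on \<Omega> B" and "closed_segment a b \<subseteq> \<Omega>"
    and "0 \<le> t" "t \<le> 1" and "ereal \<alpha> \<le> B a" "ereal \<beta> \<le> B b"
  shows "ereal ((1 - t) * \<alpha> + t * \<beta>) \<le> B ((1 - t) *\<^sub>R a + t *\<^sub>R b)"
proof -
  have cv: "convex (subgraph_on (closed_segment a b) B)"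
    using assms(1,2) unfolding locally_concave_on_def ereal_concave_on_def by blast
  have "(a, \<alpha>) \<in> subgraph_on (closed_segment a b) B" "(b, \<beta>) \<in> subgraph_on (closed_segment a b) B"
    using assms by (auto simp: subgraph_on_def)
  then have "(1 - t) *\<^sub>R (a, \<alpha>) + t *\<^sub>R (b, \<beta>) \<in> subgraph_on (closed_segment a b) B"
    using cv assms(3,4) unfolding convex_alt by blast
  then show ?thesis by (simp add: subgraph_on_def)
qed

lemma locally_concave_onI:
  assumes "\<And>a b \<alpha> \<beta> t. \<lbrakk>closed_segment a b \<subseteq> \<Omega>; 0 \<le> t; t \<le> 1; ereal \<alpha> \<le> B a; ereal \<beta> \<le> B b\<rbrakk>
    \<Longrightarrow> ereal ((1 - t) * \<alpha> + t * \<beta>) \<le> B ((1 - t) *\<^sub>R a + t *\<^sub>R b)"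
  shows "locally_concave_on \<Omega> B"
  unfolding locally_concave_on_def ereal_concave_on_def
proof (intro allI impI conjI)
  fix a b assume ab: "closed_segment a b \<subseteq> \<Omega>"
  show "convex (subgraph_on (closed_segment a b) B)"
    unfolding convex_alt
  proof (intro ballI allI impI)
    fix p q :: "'a \<times> real" and t :: real
    assume p: "p \<in> subgraph_on (closed_segment a b) B" and q: "q \<in> subgraph_on (closed_segment a b) B"
      and t: "0 \<le> t \<and> t \<le> 1"
    have pq: "closed_segment (fst p) (fst q) \<subseteq> closed_segment a b"
      using p q by (intro closed_segment_subset) (auto simp: subgraph_on_def)
    have "(1 - t) *\<^sub>R fst p + t *\<^sub>R fst q \<in> closed_segment (fst p) (fst q)"
      using t unfolding closed_segment_def by auto
    moreover have "ereal ((1 - t) * snd p + t * snd q) \<le> B ((1 - t) *\<^sub>R fst p + t *\<^sub>R fst q)"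
      using p q t pq ab by (intro assms) (auto simp: subgraph_on_def)
    ultimately show "(1 - t) *\<^sub>R p + t *\<^sub>R q \<in> subgraph_on (closed_segment a b) B"
      using pq by (cases p; cases q) (auto simp: subgraph_on_def)
  qed
qed simp

text \<open>
  The subgraph of an infimum is the intersection of the subgraphs.
\<close>

lemma locally_concave_on_min_locally_concave:
  "locally_concave_on \<Omega> (min_locally_concave \<Omega> f)"
proof (rule locally_concave_onI)
  fix a b \<alpha> \<beta> t
  assume h: "closed_segment a b \<subseteq> \<Omega>" "0 \<le> t" "t \<le> (1::real)"
    "ereal \<alpha> \<le> min_locally_concave \<Omega> f a" "ereal \<beta> \<le> min_locally_concave \<Omega> f b"
  show "ereal ((1 - t) * \<alpha> + t * \<beta>) \<le> min_locally_concave \<Omega> f ((1 - t) *\<^sub>R a + t *\<^sub>R b)"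
    unfolding min_locally_concave_def
  proof (rule Inf_greatest, clarify)
    fix B assume B: "locally_concave_on \<Omega> B" "\<forall>z\<in>\<Omega>. f z \<le> B z"
    have le: "min_locally_concave \<Omega> f z \<le> B z" for z
      unfolding min_locally_concave_def using B by (intro Inf_lower) blast
    then show "ereal ((1 - t) * \<alpha> + t * \<beta>) \<le> B ((1 - t) *\<^sub>R a + t *\<^sub>R b)"
      using h order_trans[OF h(4) le] order_trans[OF h(5) le]
      by (intro locally_concave_onD[OF B(1)])
  qed
qed

lemma min_locally_concave_ge: "z \<in> \<Omega> \<Longrightarrow> f z \<le> min_locally_concave \<Omega> f z"
  unfolding min_locally_concave_def by (rule Inf_greatest) blast

lemma min_locally_concave_le:
  "locally_concave_on \<Omega> B \<Longrightarrow> (\<And>z. z \<in> \<Omega> \<Longrightarrow> f z \<le> B z) \<Longrightarrow> min_locally_concave \<Omega> f z \<le> B z"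
  unfolding min_locally_concave_def by (rule Inf_lower) blast

lemma continuous_on_locally_concave:
  fixes B :: "'a::euclidean_space \<Rightarrow> ereal"
  assumes B: "locally_concave_on \<Omega> B" and fin: "\<And>z. z \<in> interior \<Omega> \<Longrightarrow> \<bar>B z\<bar> \<noteq> \<infinity>"
  shows "continuous_on (interior \<Omega>) (\<lambda>z. real_of_ereal (B z))"
proof (rule continuous_at_imp_continuous_on, rule ballI)
  fix x assume "x \<in> interior \<Omega>"
  then obtain r where r: "r > 0" "ball x r \<subseteq> interior \<Omega>"
    using open_contains_ball open_interior by blast
  have "convex_on (ball x r) (\<lambda>z. - real_of_ereal (B z))"
  proof (rule convex_onI)
    fix t :: real and a b assume t: "0 < t" "t < 1" and a: "a \<in> ball x r" and b: "b \<in> ball x r"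
    have ab: "closed_segment a b \<subseteq> ball x r"
      using a b by (intro closed_segment_subset) auto
    have "(1 - t) *\<^sub>R a + t *\<^sub>R b \<in> closed_segment a b"
      using t unfolding closed_segment_def by auto
    then have w: "\<bar>B ((1 - t) *\<^sub>R a + t *\<^sub>R b)\<bar> \<noteq> \<infinity>"
      by (intro fin subsetD[OF r(2)] subsetD[OF ab])
    have fa: "\<bar>B a\<bar> \<noteq> \<infinity>" "\<bar>B b\<bar> \<noteq> \<infinity>"
      using a b by (auto intro!: fin subsetD[OF r(2)])
    have "ereal ((1 - t) * real_of_ereal (B a) + t * real_of_ereal (B b)) \<le> B ((1 - t) *\<^sub>R a + t *\<^sub>R b)"
      using ab r t interior_subset fa by (intro locally_concave_onD[OF B]) (auto simp: ereal_real)
    then show "- real_of_ereal (B ((1 - t) *\<^sub>R a + t *\<^sub>R b))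
        \<le> (1 - t) * - real_of_ereal (B a) + t * - real_of_ereal (B b)"
      using w by (cases "B ((1 - t) *\<^sub>R a + t *\<^sub>R b)") auto
  qed simp
  then have "continuous_on (ball x r) (\<lambda>z. - real_of_ereal (B z))"
    by (intro convex_on_continuous) auto
  then have "continuous_on (ball x r) (\<lambda>z. - (- real_of_ereal (B z)))"
    by (rule continuous_on_minus)
  then show "isCont (\<lambda>z. real_of_ereal (B z)) x"
    using r by (simp add: continuous_on_eq_continuous_at)
qed

lemma affine_functional_combination:
  "affine_functional L \<Longrightarrow> L ((1 - t) *\<^sub>R a + t *\<^sub>R b) = (1 - t) * L a + t * L b"
  unfolding affine_functional_def
  by (elim exE conjE) (simp add: linear_add linear_scale, simp add: algebra_simps)

lemma continuous_on_affine_functional: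
  fixes L :: "'a::euclidean_space \<Rightarrow> real"
  assumes "affine_functional L"
  shows "continuous_on S L"
proof -
  obtain g c where g: "linear g" "\<And>z. L z = g z + c"
    using assms unfolding affine_functional_def by blast
  have "continuous_on S (\<lambda>z. g z + c)"
    using g by (intro continuous_intros linear_continuous_on) (simp add: linear_conv_bounded_linear)
  then show ?thesis by (simp add: g(2)[abs_def])
qed

lemma affine_functional_subtract_inner:
  assumes "affine_functional L"
  shows "affine_functional (\<lambda>z. L z - d * (b - a \<bullet> z))"
proof -
  obtain g c where g: "linear g" "\<And>z. L z = g z + c"
    using assms unfolding affine_functional_def by blast
  have "linear (\<lambda>z. g z + d * (a \<bullet> z))"
    using g(1) by (intro linearI) (simp_all add: linear_add linear_scale inner_add_right algebra_simps)
  then show ?thesis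
    unfolding affine_functional_def
    by (intro exI[of _ "\<lambda>z. g z + d * (a \<bullet> z)"] exI[of _ "c - d * b"])
       (simp add: g(2) algebra_simps)
qed

section \<open>A minimum principle\<close>

text \<open>
  Replacing \<open>B\<close> by \<open>min B M\<close> inside the ball gives a majorant of \<open>f\<close>. It is again locally
  concave: a chord of it that exceeds \<open>M\<close> at a point of the ball also exceeds \<open>M\<close> at one end,
  which must lie outside the ball, and hence at a point where the segment crosses the sphere. There
  \<open>B \<le> M\<close>, although \<open>B\<close> lies above the chord by concavity.
\<close>

lemma min_locally_concave_minimum_principle:
  fixes f :: "'a::euclidean_space \<Rightarrow> ereal"
  assumes M: "affine_functional M"
    and fM: "\<And>z. z \<in> \<Omega> \<inter> cball y r \<Longrightarrow> f z \<le> ereal (M z)"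
    and BM: "\<And>z. z \<in> \<Omega> \<inter> sphere y r \<Longrightarrow> min_locally_concave \<Omega> f z \<le> ereal (M z)"
    and z: "z \<in> \<Omega> \<inter> cball y r"
  shows "min_locally_concave \<Omega> f z \<le> ereal (M z)"
proof -
  let ?B = "min_locally_concave \<Omega> f"
  define B' where "B' = (\<lambda>z. if z \<in> cball y r then min (?B z) (ereal (M z)) else ?B z)"
  have le: "B' z \<le> ?B z" for z by (simp add: B'_def)
  note lc = locally_concave_on_min_locally_concave[of \<Omega> f]
  \<comment> \<open>The chord exceeds \<open>M\<close> at the end \<open>a\<close> outside the ball and at a point inside; look where it crosses the sphere.\<close>
  have crossing: False
    if ab: "closed_segment a b \<subseteq> \<Omega>" and t: "0 \<le> t" "t \<le> 1"
      and \<alpha>: "ereal \<alpha> \<le> ?B a" and \<beta>: "ereal \<beta> \<le> ?B b"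
      and w: "(1 - t) *\<^sub>R a + t *\<^sub>R b \<in> cball y r"
      and gt: "(1 - t) * M a + t * M b < (1 - t) * \<alpha> + t * \<beta>"
      and a: "M a < \<alpha>" "a \<notin> cball y r"
    for a b t \<alpha> \<beta>
  proof -
    have "\<exists>s. 0 \<le> s \<and> s \<le> t \<and> dist y ((1 - s) *\<^sub>R a + s *\<^sub>R b) = r"
      using t(1) w a(2) by (intro IVT2') (auto intro!: continuous_intros)
    then obtain s where s: "0 \<le> s" "s \<le> t" "dist y ((1 - s) *\<^sub>R a + s *\<^sub>R b) = r" by blast
    let ?v = "(1 - s) *\<^sub>R a + s *\<^sub>R b"
    have "?v \<in> closed_segment a b" using s t unfolding closed_segment_def by auto
    then have "?B ?v \<le> ereal (M ?v)" using ab s by (intro BM) auto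
    moreover have "ereal ((1 - s) * \<alpha> + s * \<beta>) \<le> ?B ?v"
      using ab s t \<alpha> \<beta> by (intro locally_concave_onD[OF lc]) auto
    ultimately have 1: "(1 - s) * \<alpha> + s * \<beta> \<le> (1 - s) * M a + s * M b"
      by (metis order_trans ereal_less_eq(3) affine_functional_combination[OF M])
    have sa: "0 < \<alpha> - M a" using a by simp
    show False
    proof (cases "s = 0")
      case True then show False using 1 a by simp
    next
      case False
      then have "t > 0" using s by simp
      \<comment> \<open>The affine gap between the chord and \<open>M\<close> is positive at \<open>0\<close> and at \<open>t\<close>, hence at \<open>s\<close>.\<close>
      have "t * ((1 - s) * (\<alpha> - M a) + s * (\<beta> - M b))
          = (t - s) * (\<alpha> - M a) + s * ((1 - t) * (\<alpha> - M a) + t * (\<beta> - M b))"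
        by (simp add: algebra_simps)
      moreover have "(t - s) * (\<alpha> - M a) \<ge> 0" using s sa by simp
      moreover have "s * ((1 - t) * (\<alpha> - M a) + t * (\<beta> - M b)) > 0"
        using gt s False by (intro mult_pos_pos) (auto simp: algebra_simps)
      ultimately have "t * ((1 - s) * (\<alpha> - M a) + s * (\<beta> - M b)) > 0" by linarith
      then have "(1 - s) * (\<alpha> - M a) + s * (\<beta> - M b) > 0"
        using \<open>t > 0\<close> by (simp add: zero_less_mult_iff)
      then show False using 1 by (simp add: algebra_simps)
    qed
  qed
  have "locally_concave_on \<Omega> B'"
  proof (rule locally_concave_onI)
    fix a b \<alpha> \<beta> and t :: real
    assume ab: "closed_segment a b \<subseteq> \<Omega>" and t: "0 \<le> t" "t \<le> 1"
      and \<alpha>': "ereal \<alpha> \<le> B' a" and \<beta>': "ereal \<beta> \<le> B' b"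
    have \<alpha>: "ereal \<alpha> \<le> ?B a" and \<beta>: "ereal \<beta> \<le> ?B b"
      using \<alpha>' \<beta>' le order_trans by blast+
    let ?w = "(1 - t) *\<^sub>R a + t *\<^sub>R b"
    have 1: "ereal ((1 - t) * \<alpha> + t * \<beta>) \<le> ?B ?w"
      using locally_concave_onD[OF lc ab t \<alpha> \<beta>] .
    have "(1 - t) * \<alpha> + t * \<beta> \<le> M ?w" if w: "?w \<in> cball y r"
    proof (rule ccontr)
      assume "\<not> ?thesis"
      then have gt: "(1 - t) * M a + t * M b < (1 - t) * \<alpha> + t * \<beta>"
        by (simp add: affine_functional_combination[OF M])
      consider "M a < \<alpha>" | "M b < \<beta>" | "\<alpha> \<le> M a" "\<beta> \<le> M b" by linarith
      then show False
      proof cases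
        case 1
        then have "a \<notin> cball y r" using \<alpha>' by (auto simp: B'_def)
        then show False using crossing[OF ab t \<alpha> \<beta> w gt 1] by blast
      next
        case 2
        then have "b \<notin> cball y r" using \<beta>' by (auto simp: B'_def)
        then show False
          using crossing[of b a "1 - t" \<beta> \<alpha>] ab t \<alpha> \<beta> w gt 2
          by (simp add: closed_segment_commute add.commute)
      next
        case 3
        then have "(1 - t) * \<alpha> + t * \<beta> \<le> (1 - t) * M a + t * M b"
          using t by (intro add_mono mult_left_mono) auto
        then show False using gt by simp
      qed
    qed
    then show "ereal ((1 - t) * \<alpha> + t * \<beta>) \<le> B' ?w" using 1 by (simp add: B'_def)
  qed
  then have "?B z \<le> B' z"
    using fM min_locally_concave_ge[of _ \<Omega> f]
    by (intro min_locally_concave_le) (auto simp: B'_def)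
  also have "\<dots> \<le> ereal (M z)" using z by (simp add: B'_def)
  finally show ?thesis .
qed


section \<open>The upper semicontinuous majorant\<close>

lemma isCont_tendsto_nhds: "isCont g l \<Longrightarrow> (g \<longlongrightarrow> g l) (nhds l)"
  unfolding isCont_def tendsto_at_iff_tendsto_nhds .

lemma usc_majorant_le_affine:
  fixes L :: "'a::euclidean_space \<Rightarrow> real"
  assumes L: "affine_functional L" and r: "r > 0"
    and f: "\<And>z. z \<in> \<Omega> \<inter> ball y r \<Longrightarrow> f z \<le> ereal (L z)"
  shows "usc_majorant \<Omega> f y \<le> ereal (L y)"
  unfolding usc_majorant_def Limsup_le_iff
proof (intro allI impI)
  fix c assume c: "ereal (L y) < c"
  have "isCont L y"
    using continuous_on_affine_functional[OF L, of UNIV] by (simp add: continuous_on_eq_continuous_at)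
  then have "((\<lambda>z. ereal (L z)) \<longlongrightarrow> ereal (L y)) (nhds y)"
    by (intro tendsto_ereal isCont_tendsto_nhds)
  then have "eventually (\<lambda>z. ereal (L z) < c) (nhds y)" using c by (rule order_tendstoD(2))
  moreover have "eventually (\<lambda>z. z \<in> ball y r) (nhds y)"
    using r by (intro eventually_nhds_in_open) auto
  ultimately show "eventually (\<lambda>z. f z < c) (inf (nhds y) (principal \<Omega>))"
    unfolding eventually_inf_principal
    by eventually_elim (use f in force)
qed

lemma usc_majorant_less_affine:
  fixes L :: "'a::euclidean_space \<Rightarrow> real"
  assumes L: "affine_functional L" and less: "usc_majorant \<Omega> f y < ereal (L y)"
  obtains r \<eta> where "r > 0" "\<eta> > 0" "\<And>z. z \<in> \<Omega> \<inter> cball y r \<Longrightarrow> f z \<le> ereal (L z - \<eta>)"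
proof -
  obtain u where u: "usc_majorant \<Omega> f y < ereal u" "u < L y"
    using ereal_dense2[OF less] by auto
  define v where "v = (u + L y) / 2"
  have "isCont L y"
    using continuous_on_affine_functional[OF L, of UNIV] by (simp add: continuous_on_eq_continuous_at)
  then have "(L \<longlongrightarrow> L y) (nhds y)"
    by (rule isCont_tendsto_nhds)
  then have "eventually (\<lambda>z. v < L z) (nhds y)"
    by (rule order_tendstoD(1)) (use u in \<open>simp add: v_def\<close>)
  moreover have "eventually (\<lambda>z. z \<in> \<Omega> \<longrightarrow> f z < ereal u) (nhds y)"
    using Limsup_lessD[OF u(1)[unfolded usc_majorant_def]] unfolding eventually_inf_principal .
  ultimately have "eventually (\<lambda>z. z \<in> \<Omega> \<longrightarrow> f z \<le> ereal (L z - (v - u))) (nhds y)"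
  proof eventually_elim
    case (elim z)
    show ?case
    proof
      assume "z \<in> \<Omega>"
      then have "f z \<le> ereal u" using elim by simp
      also have "\<dots> \<le> ereal (L z - (v - u))" using elim by simp
      finally show "f z \<le> ereal (L z - (v - u))" .
    qed
  qed
  then obtain d where d: "d > 0" "\<And>z. dist z y < d \<Longrightarrow> z \<in> \<Omega> \<longrightarrow> f z \<le> ereal (L z - (v - u))"
    unfolding eventually_nhds_metric by blast
  show thesis
  proof (rule that)
    show "d / 2 > 0" "v - u > 0" using d u by (auto simp: v_def)
    show "f z \<le> ereal (L z - (v - u))" if "z \<in> \<Omega> \<inter> cball y (d / 2)" for z
      using that d by (auto simp: dist_commute)
  qed
qed

text \<open>
  At interior points \<open>B\<close> is continuous while the majorant of \<open>f\<close> is upper semicontinuous, so a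
  strict inequality between them persists nearby.
\<close>

lemma ball_subset_E_pos:
  fixes f :: "'a::euclidean_space \<Rightarrow> ereal"
  assumes fin: "\<And>z. z \<in> interior \<Omega> \<Longrightarrow> \<bar>min_locally_concave \<Omega> f z\<bar> \<noteq> \<infinity>"
    and y: "y \<in> interior \<Omega>" and less: "usc_majorant \<Omega> f y < min_locally_concave \<Omega> f y"
  obtains r where "r > 0" "ball y r \<subseteq> E_pos \<Omega> f"
proof -
  let ?b = "\<lambda>z. real_of_ereal (min_locally_concave \<Omega> f z)"
  have aff: "affine_functional (\<lambda>_::'a. u)" for u
    unfolding affine_functional_def by (intro exI[of _ "\<lambda>_. 0"] exI[of _ u]) (auto intro: linearI)
  obtain u where u: "usc_majorant \<Omega> f y < ereal u" "ereal u < min_locally_concave \<Omega> f y"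
    using ereal_dense2[OF less] by auto
  obtain r \<eta> where r: "r > 0" "\<eta> > 0" "\<And>z. z \<in> \<Omega> \<inter> cball y r \<Longrightarrow> f z \<le> ereal (u - \<eta>)"
    using usc_majorant_less_affine[OF aff u(1)] by metis
  have "isCont ?b y"
    using continuous_on_locally_concave[OF locally_concave_on_min_locally_concave fin] y
    by (simp add: continuous_on_eq_continuous_at)
  then have "(?b \<longlongrightarrow> ?b y) (nhds y)"
    by (rule isCont_tendsto_nhds)
  then have "eventually (\<lambda>z. u < ?b z) (nhds y)"
    by (rule order_tendstoD(1)) (use u fin[OF y] in \<open>cases "min_locally_concave \<Omega> f y"; auto\<close>)
  moreover have "eventually (\<lambda>z. z \<in> interior \<Omega>) (nhds y)"
    using y by (intro eventually_nhds_in_open) auto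
  moreover have "eventually (\<lambda>z. z \<in> ball y r) (nhds y)"
    using r by (intro eventually_nhds_in_open) auto
  ultimately have "eventually (\<lambda>z. z \<in> E_pos \<Omega> f) (nhds y)"
  proof eventually_elim
    case (elim z)
    have "usc_majorant \<Omega> f z \<le> ereal u"
    proof (rule usc_majorant_le_affine[OF aff])
      show "r - dist y z > 0" using elim by simp
      fix w assume w: "w \<in> \<Omega> \<inter> ball z (r - dist y z)"
      then have "dist y w \<le> r" using dist_triangle[of y w z] by auto
      then have "f w \<le> ereal (u - \<eta>)" using w by (intro r(3)) auto
      also have "\<dots> \<le> ereal u" using r by simp
      finally show "f w \<le> ereal u" .
    qed
    also have "ereal u < min_locally_concave \<Omega> f z"
      using elim fin[of z] by (cases "min_locally_concave \<Omega> f z") auto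
    finally show ?case using elim by (auto simp: E_pos_def E_zero_def)
  qed
  then show thesis
    using that unfolding eventually_nhds_metric by (metis dist_commute mem_ball subsetI)
qed

section \<open>Asymptotic contact points\<close>

text \<open>
  At interior points of \<open>\<Omega>\<close>, for continuous \<open>B\<close> and \<open>L\<close>, this is the condition \<open>L z \<le> B z\<close>. On the
  boundary it is the right substitute for contact: the set is closed, and
  away from it \<open>B\<close> stays below \<open>L\<close> by a uniform amount on compact sets.
\<close>

definition asymptotic_contact :: "'a::metric_space set \<Rightarrow> ('a \<Rightarrow> ereal) \<Rightarrow> ('a \<Rightarrow> real) \<Rightarrow> 'a set" where
  "asymptotic_contact \<Omega> B L = {z. \<forall>e>0. \<exists>w\<in>\<Omega>. dist w z < e \<and> ereal (L w - e) < B w}"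

lemma closed_asymptotic_contact: "closed (asymptotic_contact \<Omega> B L)"
  unfolding closed_def open_dist
proof
  fix z assume "z \<in> - asymptotic_contact \<Omega> B L"
  then obtain e where e: "e > 0" "\<And>w. w \<in> \<Omega> \<Longrightarrow> dist w z < e \<Longrightarrow> B w \<le> ereal (L w - e)"
    unfolding asymptotic_contact_def by force
  show "\<exists>e>0. \<forall>y. dist y z < e \<longrightarrow> y \<in> - asymptotic_contact \<Omega> B L"
  proof (intro exI[of _ "e / 2"] conjI allI impI)
    fix y assume y: "dist y z < e / 2"
    have "B w \<le> ereal (L w - e / 2)" if "w \<in> \<Omega>" "dist w y < e / 2" for w
    proof -
      have "dist w z < e" using dist_triangle[of w z y] y that by simp
      then have "B w \<le> ereal (L w - e)" using e that by blast
      also have "\<dots> \<le> ereal (L w - e / 2)" using e by simp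
      finally show ?thesis .
    qed
    then have "\<not> (\<exists>w\<in>\<Omega>. dist w y < e / 2 \<and> ereal (L w - e / 2) < B w)"
      by (meson linorder_not_le)
    moreover have "e / 2 > 0" using e by simp
    ultimately show "y \<in> - asymptotic_contact \<Omega> B L"
      unfolding asymptotic_contact_def by blast
  qed (use e in simp)
qed

lemma asymptotic_contact_subset_closure: "asymptotic_contact \<Omega> B L \<subseteq> closure \<Omega>"
proof
  fix z assume z: "z \<in> asymptotic_contact \<Omega> B L"
  have "\<exists>w\<in>\<Omega>. dist w z < e" if "e > 0" for e
    using z that unfolding asymptotic_contact_def by blast
  then show "z \<in> closure \<Omega>" by (simp add: closure_approachable)
qed

lemma uniform_gap_off_asymptotic_contact:
  assumes S: "compact S" and disj: "S \<inter> asymptotic_contact \<Omega> B L = {}"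
  obtains e where "e > 0" "\<And>w. w \<in> \<Omega> \<inter> S \<Longrightarrow> B w \<le> ereal (L w - e)"
proof -
  have "\<exists>n::nat. \<forall>w\<in>\<Omega> \<inter> S. B w \<le> ereal (L w - 1 / Suc n)"
  proof (rule ccontr)
    assume "\<not> ?thesis"
    then have "\<forall>n. \<exists>w. w \<in> \<Omega> \<inter> S \<and> ereal (L w - 1 / Suc n) < B w"
      by (auto simp: not_le)
    then obtain w where w: "\<And>n. w n \<in> \<Omega> \<inter> S" "\<And>n. ereal (L (w n) - 1 / Suc n) < B (w n)"
      by metis
    then obtain z r where z: "z \<in> S" "strict_mono r" "(w \<circ> r) \<longlonglongrightarrow> z"
      using S unfolding compact_def by (metis IntD2)
    have "z \<in> asymptotic_contact \<Omega> B L"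
      unfolding asymptotic_contact_def
    proof (intro CollectI allI impI)
      fix e :: real assume e: "e > 0"
      have "eventually (\<lambda>n. dist ((w \<circ> r) n) z < e) sequentially"
        using z(3) e by (rule tendstoD)
      then obtain N' where N': "\<And>n. n \<ge> N' \<Longrightarrow> dist ((w \<circ> r) n) z < e"
        unfolding eventually_sequentially by blast
      obtain N where N: "1 / real (Suc N) < e"
        using nat_approx_posE[OF e] by blast
      obtain n where n: "n \<ge> N" "dist ((w \<circ> r) n) z < e"
        using N'[of "max N N'"] that[of "max N N'"] by simp
      have "1 / real (Suc (r n)) \<le> 1 / real (Suc N)"
        using seq_suble[OF z(2), of n] n by (intro divide_left_mono) auto
      then have "ereal (L (w (r n)) - e) \<le> ereal (L (w (r n)) - 1 / Suc (r n))"
        using N by simp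
      also have "\<dots> < B (w (r n))" by (rule w)
      finally show "\<exists>w\<in>\<Omega>. dist w z < e \<and> ereal (L w - e) < B w"
        using n w(1)[of "r n"] by auto
    qed
    then show False using z disj by blast
  qed
  then obtain n :: nat where "\<And>w. w \<in> \<Omega> \<inter> S \<Longrightarrow> B w \<le> ereal (L w - 1 / Suc n)" by blast
  then show thesis using that[of "1 / Suc n"] by simp
qed

lemma asymptotic_contact_interior:
  fixes L :: "'a::euclidean_space \<Rightarrow> real"
  assumes B: "locally_concave_on \<Omega> B" and fin: "\<And>z. z \<in> interior \<Omega> \<Longrightarrow> \<bar>B z\<bar> \<noteq> \<infinity>"
    and L: "affine_functional L"
    and z: "z \<in> asymptotic_contact \<Omega> B L" "z \<in> interior \<Omega>"
  shows "ereal (L z) \<le> B z"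
proof (rule ccontr)
  assume "\<not> ?thesis"
  then have less: "real_of_ereal (B z) < L z" using fin[OF z(2)] by (cases "B z") auto
  define e where "e = (L z - real_of_ereal (B z)) / 2"
  have "continuous_on (interior \<Omega>) (\<lambda>w. real_of_ereal (B w) - L w)"
    by (intro continuous_on_diff continuous_on_locally_concave[OF B fin] continuous_on_affine_functional L)
  then have "isCont (\<lambda>w. real_of_ereal (B w) - L w) z"
    using z by (simp add: continuous_on_eq_continuous_at)
  then have "((\<lambda>w. real_of_ereal (B w) - L w) \<longlongrightarrow> real_of_ereal (B z) - L z) (nhds z)"
    by (rule isCont_tendsto_nhds)
  then have "eventually (\<lambda>w. real_of_ereal (B w) - L w < - e) (nhds z)"
    by (rule order_tendstoD(2)) (use less in \<open>simp add: e_def field_simps\<close>)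
  moreover have "eventually (\<lambda>w. w \<in> interior \<Omega>) (nhds z)"
    using z by (intro eventually_nhds_in_open) auto
  ultimately have "eventually (\<lambda>w. real_of_ereal (B w) - L w < - e \<and> w \<in> interior \<Omega>) (nhds z)"
    by (rule eventually_conj)
  then obtain d where d: "d > 0" "\<And>w. dist w z < d \<Longrightarrow> real_of_ereal (B w) - L w < - e \<and> w \<in> interior \<Omega>"
    unfolding eventually_nhds_metric by blast
  have "min d e > 0" using d less by (simp add: e_def)
  then obtain w where w: "dist w z < min d e" "ereal (L w - min d e) < B w"
    using z(1) unfolding asymptotic_contact_def by blast
  have "L w - e \<le> L w - min d e" by simp
  then have "ereal (L w - e) < B w" using w(2) by (meson ereal_less_eq(3) le_less_trans)
  moreover have "real_of_ereal (B w) < L w - e" "\<bar>B w\<bar> \<noteq> \<infinity>" using d(2)[of w] w fin by auto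
  ultimately show False by (cases "B w") auto
qed

text \<open>
  Concavity along the segments from \<open>x\<close> to the points witnessing that \<open>z\<close> is an asymptotic contact
  point spreads the contact to the whole segment from \<open>x\<close> to \<open>z\<close>. In this way information about
  boundary points \<open>z\<close> reaches interior points.
\<close>

lemma asymptotic_contact_homothety:
  fixes L :: "'a::euclidean_space \<Rightarrow> real"
  assumes B: "locally_concave_on \<Omega> B" and L: "affine_functional L"
    and x: "ereal (L x) \<le> B x" and z: "z \<in> asymptotic_contact \<Omega> B L"
    and r: "r > 0" "\<And>w. w \<in> \<Omega> \<inter> ball z r \<Longrightarrow> closed_segment x w \<subseteq> \<Omega>"
    and t: "0 \<le> t" "t \<le> 1"
  shows "(1 - t) *\<^sub>R x + t *\<^sub>R z \<in> asymptotic_contact \<Omega> B L"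
  unfolding asymptotic_contact_def
proof (intro CollectI allI impI)
  fix e :: real assume e: "e > 0"
  then have "min e r > 0" using r by simp
  then obtain w where w: "w \<in> \<Omega>" "dist w z < min e r" "ereal (L w - min e r) < B w"
    using z unfolding asymptotic_contact_def by blast
  have seg: "closed_segment x w \<subseteq> \<Omega>" using w by (intro r(2)) (auto simp: dist_commute)
  let ?h = "(1 - t) *\<^sub>R x + t *\<^sub>R w"
  have "L w - e \<le> L w - min e r" by simp
  then have "ereal (L w - e) < B w" using w(3) by (meson ereal_less_eq(3) le_less_trans)
  then obtain u where u: "ereal (L w - e) < ereal u" "ereal u < B w"
    using ereal_dense2 by blast
  show "\<exists>v\<in>\<Omega>. dist v ((1 - t) *\<^sub>R x + t *\<^sub>R z) < e \<and> ereal (L v - e) < B v"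
  proof (intro bexI conjI)
    show "?h \<in> \<Omega>" using seg t unfolding closed_segment_def by auto
    have "dist ?h ((1 - t) *\<^sub>R x + t *\<^sub>R z) = t * dist w z"
      using t by (simp add: dist_norm flip: scaleR_diff_right)
    also have "\<dots> \<le> dist w z" using t by (simp add: mult_left_le_one_le)
    finally show "dist ?h ((1 - t) *\<^sub>R x + t *\<^sub>R z) < e" using w by simp
    have "ereal ((1 - t) * L x + t * u) \<le> B ?h"
      using u(2) by (intro locally_concave_onD[OF B seg t x]) simp
    moreover have "L ?h - e < (1 - t) * L x + t * u"
    proof (cases "t = 0")
      case True then show ?thesis using e by simp
    next
      case False
      then have "t * (L w - e) < t * u" using u t by simp
      moreover have "t * e \<le> e" using t e by (simp add: mult_left_le_one_le)
      ultimately show ?thesis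
        unfolding affine_functional_combination[OF L] by (simp add: algebra_simps)
    qed
    ultimately show "ereal (L ?h - e) < B ?h"
      by (meson ereal_less(2) less_ereal.simps(1) less_le_trans)
  qed
qed

text \<open>
  Along the segment \<open>B - L\<close> is concave, nonnegative at \<open>x\<close> and nonpositive near \<open>x\<close>, so it cannot
  become positive further on.
\<close>

lemma le_affine_of_contact:
  fixes L :: "'a::real_normed_vector \<Rightarrow> real"
  assumes B: "locally_concave_on \<Omega> B" and L: "affine_functional L"
    and seg: "closed_segment x w \<subseteq> \<Omega>"
    and x: "ereal (L x) \<le> B x"
    and \<rho>: "\<rho> > 0" "\<And>z. z \<in> \<Omega> \<inter> ball x \<rho> \<Longrightarrow> B z \<le> ereal (L z)"
  shows "B w \<le> ereal (L w)"
proof (rule ccontr)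
  assume "\<not> ?thesis"
  then obtain u where u: "ereal (L w) < ereal u" "ereal u < B w"
    using ereal_dense2 not_le by metis
  define s where "s = \<rho> / (\<rho> + norm (w - x))"
  have s: "0 < s" "s \<le> 1" using \<rho> by (auto simp: s_def add_pos_nonneg)
  let ?p = "(1 - s) *\<^sub>R x + s *\<^sub>R w"
  have "s * norm (w - x) < \<rho>"
  proof -
    have "\<rho> * norm (w - x) < \<rho> * (\<rho> + norm (w - x))" using \<rho> by simp
    then show ?thesis using \<rho> by (simp add: s_def pos_divide_less_eq add_pos_nonneg)
  qed
  moreover have "x - ?p = s *\<^sub>R (x - w)" by (simp add: algebra_simps)
  ultimately have "dist x ?p < \<rho>" using s by (simp add: dist_norm norm_minus_commute)
  moreover have "?p \<in> closed_segment x w" using s unfolding closed_segment_def by auto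
  then have "?p \<in> \<Omega>" using seg by blast
  ultimately have "B ?p \<le> ereal (L ?p)" by (intro \<rho>(2)) auto
  moreover have "ereal ((1 - s) * L x + s * u) \<le> B ?p"
    using u(2) s by (intro locally_concave_onD[OF B seg _ _ x]) auto
  ultimately have "ereal ((1 - s) * L x + s * u) \<le> ereal (L ?p)" by (rule order_trans[rotated])
  then have "s * u \<le> s * L w" by (simp add: affine_functional_combination[OF L])
  then show False using u s by simp
qed

section \<open>No isolated extreme contact points\<close>

text \<open>
  If \<open>y\<close> is outside this hull, it is strictly separated from it by \<open>g z = b - a \<bullet> z\<close>, with \<open>g y > 0\<close>.
  The part of the sphere of radius \<open>\<rho>\<close> where \<open>g \<ge> 0\<close> is then free of asymptotic contact points and
  carries a uniform gap between \<open>B\<close> and \<open>L\<close>. The minimum principle applies to \<open>L - d * g\<close> with small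
  \<open>d\<close> and rules out contact near \<open>y\<close>.
\<close>

lemma contact_point_in_convex_hull:
  fixes f :: "'a::euclidean_space \<Rightarrow> ereal"
  assumes L: "affine_functional L" and less: "usc_majorant \<Omega> f y < ereal (L y)"
    and r: "r > 0" "\<And>z. z \<in> \<Omega> \<inter> cball y r \<Longrightarrow> min_locally_concave \<Omega> f z \<le> ereal (L z)"
    and y: "y \<in> closure {z \<in> \<Omega>. min_locally_concave \<Omega> f z = ereal (L z)}"
  obtains \<rho> where "\<rho> > 0"
    "y \<in> convex hull (asymptotic_contact \<Omega> (min_locally_concave \<Omega> f) L \<inter> cball y r - ball y \<rho>)"
proof -
  let ?B = "min_locally_concave \<Omega> f"
  let ?C = "asymptotic_contact \<Omega> ?B L"
  obtain r1 \<eta> where r1: "r1 > 0" "\<eta> > 0" "\<And>z. z \<in> \<Omega> \<inter> cball y r1 \<Longrightarrow> f z \<le> ereal (L z - \<eta>)"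
    using usc_majorant_less_affine[OF L less] by blast
  \<comment> \<open>The points at distance exactly \<open>\<rho>\<close> are kept in the hull below, so the separation controls the sphere.\<close>
  define \<rho> where "\<rho> = min r r1"
  have \<rho>: "\<rho> > 0" "\<rho> \<le> r" "\<rho> \<le> r1" using r r1 by (auto simp: \<rho>_def)
  let ?A = "?C \<inter> cball y r - ball y \<rho>"
  have "y \<in> convex hull ?A"
  proof (rule ccontr)
    assume notin: "y \<notin> convex hull ?A"
    have "compact (?C \<inter> cball y r)"
      using closed_asymptotic_contact by (intro closed_Int_compact) auto
    then have "closed (convex hull ?A)"
      by (intro compact_imp_closed compact_convex_hull compact_diff) auto
    then obtain a b where ab: "a \<bullet> y < b" "\<And>z. z \<in> convex hull ?A \<Longrightarrow> a \<bullet> z > b"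
      using separating_hyperplane_closed_point[OF convex_convex_hull _ notin] by blast
    let ?S = "sphere y \<rho> \<inter> {z. a \<bullet> z \<le> b}"
    have "?S \<inter> ?C = {}"
    proof (rule ccontr)
      assume "?S \<inter> ?C \<noteq> {}"
      then obtain z where z: "z \<in> ?S" "z \<in> ?C" by blast
      then have "z \<in> ?A" using \<rho> by auto
      then show False using ab(2)[of z] z hull_inc[of z ?A] by auto
    qed
    moreover have "compact ?S"
      by (intro compact_Int_closed compact_sphere closed_halfspace_le)
    ultimately obtain e where e: "e > 0" "\<And>w. w \<in> \<Omega> \<inter> ?S \<Longrightarrow> ?B w \<le> ereal (L w - e)"
      using uniform_gap_off_asymptotic_contact[of ?S \<Omega> ?B L] by metis
    obtain m where m: "m \<in> cball y \<rho>" "\<And>z. z \<in> cball y \<rho> \<Longrightarrow> b - a \<bullet> z \<le> b - a \<bullet> m"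
      using continuous_attains_sup[of "cball y \<rho>" "\<lambda>z. b - a \<bullet> z"] \<rho>
      by (force intro!: continuous_intros)
    define G where "G = b - a \<bullet> m"
    have "b - a \<bullet> y \<le> G" using m(2)[of y] \<rho> by (simp add: G_def)
    then have G: "G > 0" using ab by simp
    define d where "d = min e \<eta> / G"
    have d: "d > 0" using e r1 G by (simp add: d_def)
    have dG: "d * (b - a \<bullet> z) \<le> min e \<eta>" if "z \<in> cball y \<rho>" for z
    proof -
      have "d * (b - a \<bullet> z) \<le> d * G" using m(2)[OF that] d by (simp add: G_def)
      then show ?thesis using G by (simp add: d_def)
    qed
    let ?M = "\<lambda>z. L z - d * (b - a \<bullet> z)"
    have BM: "?B z \<le> ereal (?M z)" if "z \<in> \<Omega> \<inter> cball y \<rho>" for z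
    proof (rule min_locally_concave_minimum_principle[OF affine_functional_subtract_inner[OF L] _ _ that])
      fix w assume w: "w \<in> \<Omega> \<inter> cball y \<rho>"
      then have "f w \<le> ereal (L w - \<eta>)" using \<rho> by (intro r1(3)) auto
      also have "\<dots> \<le> ereal (?M w)" using dG[of w] w by simp
      finally show "f w \<le> ereal (?M w)" .
    next
      fix w assume w: "w \<in> \<Omega> \<inter> sphere y \<rho>"
      show "?B w \<le> ereal (?M w)"
      proof (cases "a \<bullet> w \<le> b")
        case True
        then have "?B w \<le> ereal (L w - e)" using w by (intro e(2)) auto
        also have "\<dots> \<le> ereal (?M w)" using dG[of w] w by simp
        finally show ?thesis .
      next
        case False
        have "?B w \<le> ereal (L w)" using w \<rho> by (intro r(2)) auto
        also have "\<dots> \<le> ereal (?M w)" using False d by (simp add: mult_nonneg_nonpos)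
        finally show ?thesis .
      qed
    qed
    let ?V = "ball y \<rho> \<inter> {z. a \<bullet> z < b}"
    have "open ?V" by (intro open_Int open_ball open_halfspace_lt)
    moreover have "y \<in> ?V" using ab \<rho> by simp
    ultimately have "?V \<inter> {z \<in> \<Omega>. ?B z = ereal (L z)} \<noteq> {}"
      using y open_Int_closure_eq_empty by blast
    then obtain z where z: "z \<in> ?V" "z \<in> \<Omega>" "?B z = ereal (L z)" by blast
    have "L z \<le> ?M z" using BM[of z] z by auto
    then show False using z d by (simp add: mult_le_0_iff)
  qed
  then show thesis using that \<rho> by blast
qed

text \<open>
  A point of the face that lies in the hull of \<open>A\<close> already lies in the hull of \<open>A \<inter> F\<close>, which is
  contained in an open half-space with \<open>p\<close> on its boundary.
\<close>

lemma face_point_not_in_convex_hull: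
  fixes A :: "'a::euclidean_space set"
  assumes F: "F face_of U" and U: "convex U" and A: "compact A" "A \<subseteq> U" and p: "p \<in> F"
    and side: "\<And>z. z \<in> A \<inter> F \<Longrightarrow> v \<bullet> z < v \<bullet> p"
  shows "p \<notin> convex hull A"
proof
  assume pA: "p \<in> convex hull A"
  have "convex hull A \<subseteq> U" using A U by (simp add: hull_minimal)
  then have "(F \<inter> convex hull A) face_of (convex hull A)"
    using face_of_slice[OF F convex_convex_hull[of A]] by (simp add: Int_absorb1)
  then obtain S where S: "S \<subseteq> A" "F \<inter> convex hull A = convex hull S"
    using face_of_convex_hull_subset[OF A(1)] by metis
  have "S \<subseteq> A \<inter> F" using S hull_subset[of S convex] by blast
  then have "S \<subseteq> {z. v \<bullet> z < v \<bullet> p}" using side by blast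
  then have "convex hull S \<subseteq> {z. v \<bullet> z < v \<bullet> p}"
    by (rule hull_minimal) (rule convex_halfspace_lt)
  then show False using p pA S by blast
qed

lemma convex_contact_set:
  assumes W: "convex W" "W \<subseteq> \<Omega>" and L: "affine_functional L"
    and le: "\<And>z. z \<in> W \<Longrightarrow> min_locally_concave \<Omega> f z \<le> ereal (L z)"
  shows "convex (contact_set \<Omega> f W L)"
  unfolding convex_alt
proof (intro ballI allI impI)
  fix a b and t :: real
  assume a: "a \<in> contact_set \<Omega> f W L" and b: "b \<in> contact_set \<Omega> f W L" and t: "0 \<le> t \<and> t \<le> 1"
  let ?c = "(1 - t) *\<^sub>R a + t *\<^sub>R b"
  have ab: "a \<in> W" "b \<in> W" using a b by (auto simp: contact_set_def)
  have c: "?c \<in> W" using W(1) ab t unfolding convex_alt by blast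
  have "closed_segment a b \<subseteq> \<Omega>" using closed_segment_subset[OF ab W(1)] W(2) by blast
  then have "ereal ((1 - t) * L a + t * L b) \<le> min_locally_concave \<Omega> f ?c"
    using a b t
    by (intro locally_concave_onD[OF locally_concave_on_min_locally_concave]) (auto simp: contact_set_def)
  then show "?c \<in> contact_set \<Omega> f W L"
    using le[OF c] c by (simp add: contact_set_def affine_functional_combination[OF L] antisym)
qed

section \<open>Pre-extremal sets on a line\<close>

lemma is_line_eq_range:
  assumes l: "is_line l" and xy: "x \<in> l" "y \<in> l" "x \<noteq> y"
  shows "affine hull {x, y} = l" "l = range (\<lambda>u. x + u *\<^sub>R (y - x))"
proof -
  have "aff_dim {x, y} = aff_dim l" using l xy by (simp add: is_line_def aff_dim_2)
  then have "affine hull {x, y} = affine hull l"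
    using xy aff_dim_eq_full_gen[of "{x, y}" l] by simp
  then show "affine hull {x, y} = l" using l by (simp add: is_line_def affine_hull_eq)
  then show "l = range (\<lambda>u. x + u *\<^sub>R (y - x))" by (simp add: affine_hull_2_alt)
qed

lemma usc_majorant_less_of_E_pos:
  fixes f :: "'a::euclidean_space \<Rightarrow> ereal"
  assumes L: "affine_functional L" and p: "p \<in> E_pos \<Omega> f" "min_locally_concave \<Omega> f p = ereal (L p)"
    and r: "r > 0" "\<And>z. z \<in> \<Omega> \<inter> ball p r \<Longrightarrow> min_locally_concave \<Omega> f z \<le> ereal (L z)"
  shows "usc_majorant \<Omega> f p < ereal (L p)"
proof -
  have "usc_majorant \<Omega> f p \<le> ereal (L p)"
    using r min_locally_concave_ge order_trans
    by (intro usc_majorant_le_affine[OF L r(1)]) blast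
  moreover have "usc_majorant \<Omega> f p \<noteq> ereal (L p)"
    using p by (auto simp: E_pos_def E_zero_def)
  ultimately show ?thesis by simp
qed

text \<open>
  The set \<open>W\<close> that certifies \<open>p\<close> also certifies its neighbours on \<open>l\<close>, provided that the contact
  set continues on \<open>l\<close> on both sides of \<open>p\<close>. If it stopped at \<open>p\<close> in some direction, \<open>p\<close> would be an
  extreme point of the contact set, contrary to \<open>contact_point_in_convex_hull\<close>.
\<close>

lemma pre_extremal_set_open_in_line:
  fixes f :: "'a::euclidean_space \<Rightarrow> ereal"
  assumes fin: "\<And>z. z \<in> interior \<Omega> \<Longrightarrow> \<bar>min_locally_concave \<Omega> f z\<bar> \<noteq> \<infinity>"
    and l: "is_line l" and L: "affine_functional L" and p: "p \<in> pre_extremal_set \<Omega> f L l"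
  obtains e where "e > 0" "ball p e \<inter> l \<subseteq> pre_extremal_set \<Omega> f L l"
proof -
  let ?B = "min_locally_concave \<Omega> f"
  note lc = locally_concave_on_min_locally_concave[of \<Omega> f]
  from p obtain W where W: "closed W" "convex W" "W \<subseteq> E_pos \<Omega> f" "interior W \<noteq> {}" "p \<in> interior W"
    and le: "\<And>z. z \<in> W \<Longrightarrow> ?B z \<le> ereal (L z)"
    and pU: "p \<in> contact_set \<Omega> f W L"
    and face: "(l \<inter> contact_set \<Omega> f W L) face_of contact_set \<Omega> f W L"
    and hull: "affine hull (l \<inter> contact_set \<Omega> f W L) = l"
    and pl: "p \<in> l" "p \<in> E_pos \<Omega> f"
    unfolding pre_extremal_set_def by blast
  let ?U = "contact_set \<Omega> f W L"
  have WI: "W \<subseteq> interior \<Omega>" using W(3) by (auto simp: E_pos_def)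
  then have W\<Omega>: "W \<subseteq> \<Omega>" using interior_subset by blast
  have cU: "convex ?U" using convex_contact_set[OF W(2) W\<Omega> L le] .
  obtain r where r: "r > 0" "cball p r \<subseteq> interior W"
    using W(5) open_contains_cball open_interior by blast
  have rW: "cball p r \<subseteq> W" using r interior_subset by blast
  have Bp: "?B p = ereal (L p)" using pU by (simp add: contact_set_def)
  have less: "usc_majorant \<Omega> f p < ereal (L p)"
    using rW by (intro usc_majorant_less_of_E_pos[OF L pl(2) Bp r(1)] le) auto
  let ?C = "asymptotic_contact \<Omega> ?B L"
  have CU: "?C \<inter> cball p r \<subseteq> ?U"
  proof
    fix z assume z: "z \<in> ?C \<inter> cball p r"
    then have zW: "z \<in> W" using rW by blast
    have "ereal (L z) \<le> ?B z"
      using z zW WI by (intro asymptotic_contact_interior[OF lc fin L]) auto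
    then show "z \<in> ?U" using le[OF zW] zW by (simp add: contact_set_def antisym)
  qed
  have ahead: "\<exists>s>0. p + s *\<^sub>R v \<in> ?U" if v: "v \<noteq> 0" "l = range (\<lambda>s. p + s *\<^sub>R v)" for v
  proof (rule ccontr)
    assume none: "\<not> ?thesis"
    have "p \<in> closure {z \<in> \<Omega>. ?B z = ereal (L z)}"
      using Bp pU W\<Omega> by (intro subsetD[OF closure_subset]) (auto simp: contact_set_def)
    then obtain \<rho> where \<rho>: "\<rho> > 0" "p \<in> convex hull (?C \<inter> cball p r - ball p \<rho>)"
      using contact_point_in_convex_hull[OF L less r(1), of thesis] rW le by blast
    have "compact (?C \<inter> cball p r)"
      using closed_asymptotic_contact by (intro closed_Int_compact) auto
    then have cA: "compact (?C \<inter> cball p r - ball p \<rho>)" by (intro compact_diff) auto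
    have "v \<bullet> z < v \<bullet> p" if z: "z \<in> (?C \<inter> cball p r - ball p \<rho>) \<inter> (l \<inter> ?U)" for z
    proof -
      obtain s where s: "z = p + s *\<^sub>R v" using z v by blast
      have "\<not> s > 0" using none z s by blast
      moreover have "s \<noteq> 0" using z s \<rho>(1) by auto
      ultimately have "s * (v \<bullet> v) < 0" using v(1) by (intro mult_neg_pos) auto
      then show ?thesis by (simp add: s inner_add_right)
    qed
    moreover have "?C \<inter> cball p r - ball p \<rho> \<subseteq> ?U" using CU by blast
    ultimately have "p \<notin> convex hull (?C \<inter> cball p r - ball p \<rho>)"
      using pl pU by (intro face_point_not_in_convex_hull[OF face cU cA]) auto
    then show False using \<rho> by blast
  qed
  have "l \<noteq> {p}" using l by (auto simp: is_line_def)
  then obtain q where q: "q \<in> l" "q \<noteq> p" using pl by blast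
  define v where "v = q - p"
  have v: "v \<noteq> 0" "l = range (\<lambda>s. p + s *\<^sub>R v)"
    using q is_line_eq_range(2)[OF l pl(1) q(1)] by (auto simp: v_def)
  have "range (\<lambda>s. p + s *\<^sub>R (- v)) = range (\<lambda>s. p + s *\<^sub>R v)"
    by (force intro: image_eqI[of _ _ "- s" for s])
  then obtain s1 s2 where s1: "s1 > 0" "p + s1 *\<^sub>R v \<in> ?U" and s2: "s2 > 0" "p + s2 *\<^sub>R (- v) \<in> ?U"
    using ahead[OF v] ahead[of "- v"] v by auto
  define e where "e = min r (min s1 s2 * norm v)"
  show thesis
  proof (rule that)
    show "e > 0" using r s1 s2 v by (simp add: e_def)
    show "ball p e \<inter> l \<subseteq> pre_extremal_set \<Omega> f L l"
    proof
      fix z assume z: "z \<in> ball p e \<inter> l"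
      then obtain s where s: "z = p + s *\<^sub>R v" using v by blast
      have "\<bar>s\<bar> * norm v < min s1 s2 * norm v"
        using z by (simp add: s e_def dist_norm)
      then have "\<bar>s\<bar> < min s1 s2" using v(1) by (simp add: mult_less_cancel_right)
      then have ss: "- s2 < s" "s < s1" by auto
      define u where "u = (s + s2) / (s1 + s2)"
      have u: "0 \<le> u" "u \<le> 1" using ss s1 s2 by (auto simp: u_def field_simps)
      have us: "u * (s1 + s2) = s + s2" using s1 s2 by (simp add: u_def)
      have "(1 - u) *\<^sub>R (p + s2 *\<^sub>R (- v)) + u *\<^sub>R (p + s1 *\<^sub>R v) = p + (u * (s1 + s2) - s2) *\<^sub>R v"
        by (simp add: algebra_simps)
      also have "\<dots> = z" by (simp add: us s)
      finally have "z \<in> ?U"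
        using cU s1(2) s2(2) u unfolding convex_alt by metis
      moreover have "z \<in> interior W" using z r by (auto simp: e_def)
      moreover have "z \<in> l" "z \<in> E_pos \<Omega> f"
        using z \<open>z \<in> interior W\<close> interior_subset W(3) by blast+
      ultimately show "z \<in> pre_extremal_set \<Omega> f L l"
        unfolding pre_extremal_set_def using W le face hull by blast
    qed
  qed
qed


text \<open>
  A component contains every point of the pre-extremal set that lies in its closure, and by openness it
  contains a neighbourhood of that point in \<open>l\<close>.
\<close>

lemma frontier_of_extremal_set:
  fixes f :: "'a::euclidean_space \<Rightarrow> ereal"
  assumes fin: "\<And>z. z \<in> interior \<Omega> \<Longrightarrow> \<bar>min_locally_concave \<Omega> f z\<bar> \<noteq> \<infinity>"
    and l: "is_line l" and L: "affine_functional L"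
    and y: "y \<in> top_of_set l frontier_of extremal_set \<Omega> f x L l"
  shows "y \<in> l" "y \<in> closure (extremal_set \<Omega> f x L l)" "y \<notin> pre_extremal_set \<Omega> f L l"
proof -
  let ?E = "extremal_set \<Omega> f x L l" and ?P = "pre_extremal_set \<Omega> f L l"
  have El: "?E \<subseteq> ?P" "?P \<subseteq> l"
    unfolding extremal_set_def by (auto simp: connected_component_subset pre_extremal_set_def)
  have yc: "y \<in> top_of_set l closure_of ?E" "y \<notin> top_of_set l interior_of ?E"
    using y by (auto simp: frontier_of_def)
  show yl: "y \<in> l" using yc(1) closure_of_subset_topspace by force
  show ycl: "y \<in> closure ?E"
    using yc(1) El by (auto simp: closure_of_subtopology Int_absorb1)
  show "y \<notin> ?P"
  proof
    assume yP: "y \<in> ?P"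
    have cE: "connected ?E" unfolding extremal_set_def by simp
    have "?E \<noteq> {}" using ycl by auto
    then have "x \<in> ?E"
      unfolding extremal_set_def connected_component_eq_empty by simp
    moreover have "connected (insert y ?E)"
      using ycl closure_subset by (intro connected_intermediate_closure[OF cE]) auto
    ultimately have "insert y ?E \<subseteq> ?E"
      using yP El unfolding extremal_set_def
      by (intro connected_component_maximal) auto
    then have yE: "y \<in> ?E" by blast
    obtain e where e: "e > 0" "ball y e \<inter> l \<subseteq> ?P"
      using pre_extremal_set_open_in_line[OF fin l L yP] by metis
    have "affine l" using l by (simp add: is_line_def)
    then have "connected (ball y e \<inter> l)"
      by (intro convex_connected convex_Int convex_ball affine_imp_convex)
    then have "ball y e \<inter> l \<subseteq> connected_component_set ?P y"
      using e yl by (intro connected_component_maximal) auto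
    also have "\<dots> = ?E"
      using yE unfolding extremal_set_def by (metis connected_component_eq)
    finally have "ball y e \<inter> l \<subseteq> ?E" .
    moreover have "openin (top_of_set l) (ball y e \<inter> l)"
      by (metis Int_commute openin_open_Int open_ball)
    ultimately have "y \<in> top_of_set l interior_of ?E"
      using e yl unfolding interior_of_def by auto
    then show False using yc(2) by blast
  qed
qed

lemma half_open_segment_subset_connected:
  fixes x y :: "'a::euclidean_space"
  assumes E: "connected E" "E \<subseteq> range (\<lambda>u. x + u *\<^sub>R (y - x))" and x: "x \<in> E" and y: "y \<in> closure E"
    and t: "0 \<le> t" "t < 1"
  shows "(1 - t) *\<^sub>R x + t *\<^sub>R y \<in> E"
proof (cases "x = y")
  case True
  then show ?thesis using x by (simp flip: scaleR_add_left)
next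
  case False
  define n where "n = (y - x) \<bullet> (y - x)"
  have n: "n > 0" using False by (simp add: n_def)
  define \<phi> where "\<phi> = (\<lambda>z. (y - x) \<bullet> (z - x))"
  have "connected (\<phi> ` E)"
    unfolding \<phi>_def using E by (intro connected_continuous_image continuous_intros)
  moreover have "0 \<in> \<phi> ` E" using x by (intro image_eqI[of _ _ x]) (simp_all add: \<phi>_def)
  moreover obtain e where e: "e \<in> E" "t * n < \<phi> e"
  proof -
    have "open {z. t * n < \<phi> z}"
      unfolding \<phi>_def by (intro open_Collect_less continuous_intros)
    moreover have "y \<in> {z. t * n < \<phi> z}" using t n by (simp add: \<phi>_def flip: n_def)
    ultimately have "{z. t * n < \<phi> z} \<inter> E \<noteq> {}"
      using y open_Int_closure_eq_empty by blast
    then show thesis using that by blast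
  qed
  ultimately have "{0..\<phi> e} \<subseteq> \<phi> ` E" by (intro connected_contains_Icc) auto
  moreover have "t * n \<in> {0..\<phi> e}" using t n e by simp
  ultimately obtain w where w: "w \<in> E" "\<phi> w = t * n" by (metis imageE subsetD)
  obtain u where u: "w = x + u *\<^sub>R (y - x)" using w E by blast
  have "u * n = t * n" using w by (simp add: \<phi>_def u n_def)
  then have "w = (1 - t) *\<^sub>R x + t *\<^sub>R y" using n by (simp add: u algebra_simps)
  then show ?thesis using w by simp
qed

section \<open>The end points of extremal sets on a line\<close>

theorem theorem13p1:
  fixes \<Omega> :: "'a::euclidean_space set"
    and f :: "'a \<Rightarrow> ereal"
    and l :: "'a set"
    and L :: "'a \<Rightarrow> real"
    and x y :: 'a
  assumes finite_B: "\<And>z. z \<in> interior \<Omega> \<Longrightarrow> \<bar>min_locally_concave \<Omega> f z\<bar> \<noteq> \<infinity>"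
    and line: "is_line l"
    and affine_L: "affine_functional L"
    and x: "x \<in> pre_extremal_set \<Omega> f L l"
    and y: "y \<in> top_of_set l frontier_of extremal_set \<Omega> f x L l"
    and cone: "\<exists>\<epsilon>>0. \<forall>z \<in> cball y \<epsilon> \<inter> closure \<Omega>. right_open_segment x z \<subseteq> interior \<Omega>"
  shows "ereal (L y) = usc_majorant \<Omega> f y"
proof (rule ccontr)
  assume neq: "ereal (L y) \<noteq> usc_majorant \<Omega> f y"
  let ?B = "min_locally_concave \<Omega> f"
  let ?E = "extremal_set \<Omega> f x L l" and ?P = "pre_extremal_set \<Omega> f L l"
  let ?C = "asymptotic_contact \<Omega> ?B L"
  note lc = locally_concave_on_min_locally_concave[of \<Omega> f]
  from x obtain W where W: "closed W" "convex W" "W \<subseteq> E_pos \<Omega> f" "x \<in> interior W"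
    and leW: "\<And>z. z \<in> W \<Longrightarrow> ?B z \<le> ereal (L z)"
    and xU: "x \<in> contact_set \<Omega> f W L"
    and face: "(l \<inter> contact_set \<Omega> f W L) face_of contact_set \<Omega> f W L"
    and xl: "x \<in> l"
    unfolding pre_extremal_set_def by blast
  let ?U = "contact_set \<Omega> f W L"
  have W\<Omega>: "W \<subseteq> \<Omega>" "W \<subseteq> interior \<Omega>"
    using W(3) interior_subset[of \<Omega>] by (auto simp: E_pos_def)
  have cU: "convex ?U" using convex_contact_set[OF W(2) W\<Omega>(1) affine_L leW] .
  have Bx: "?B x = ereal (L x)" using xU by (simp add: contact_set_def)
  obtain \<rho> where \<rho>: "\<rho> > 0" "ball x \<rho> \<subseteq> interior W"
    using W(4) open_contains_ball open_interior by blast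
  have \<rho>W: "ball x \<rho> \<subseteq> W" using \<rho> interior_subset by blast
  have le: "?B w \<le> ereal (L w)" if "closed_segment x w \<subseteq> \<Omega>" for w
    using \<rho>W Bx by (intro le_affine_of_contact[OF lc affine_L that _ \<rho>(1)] leW) auto
  have yl: "y \<in> l" and ycl: "y \<in> closure ?E" and yP: "y \<notin> ?P"
    using frontier_of_extremal_set[OF finite_B line affine_L y] by blast+
  have xy: "x \<noteq> y" using x yP by blast
  define n where "n = norm (y - x)"
  have n: "n > 0" using xy by (simp add: n_def)
  note l_eq = is_line_eq_range(2)[OF line xl yl xy]
  have EP: "?E \<subseteq> ?P" unfolding extremal_set_def by (rule connected_component_subset)
  have P: "?B z = ereal (L z)" "z \<in> l" "z \<in> interior \<Omega>" if "z \<in> ?P" for z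
    using that by (auto simp: pre_extremal_set_def contact_set_def E_pos_def)
  have seg_E: "(1 - t) *\<^sub>R x + t *\<^sub>R y \<in> ?P" if "0 \<le> t" "t < 1" for t
  proof -
    have "?E \<subseteq> range (\<lambda>u. x + u *\<^sub>R (y - x))" using P(2) EP l_eq by blast
    moreover have "connected ?E" "x \<in> ?E"
      using x by (auto simp: extremal_set_def)
    ultimately show ?thesis
      using half_open_segment_subset_connected[OF _ _ _ ycl that] EP by blast
  qed
  obtain \<epsilon> where \<epsilon>: "\<epsilon> > 0"
    and cone\<epsilon>: "\<And>z. z \<in> cball y \<epsilon> \<inter> closure \<Omega> \<Longrightarrow> right_open_segment x z \<subseteq> interior \<Omega>"
    using cone by blast
  have ray: "(1 - t) *\<^sub>R x + t *\<^sub>R z \<in> interior \<Omega>"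
    if "z \<in> cball y \<epsilon> \<inter> closure \<Omega>" "0 \<le> t" "t < 1" for z t
    using cone\<epsilon>[OF that(1)] that unfolding right_open_segment_def by blast
  have seg\<Omega>: "closed_segment x z \<subseteq> \<Omega>" if "z \<in> \<Omega> \<inter> cball y \<epsilon>" for z
  proof
    fix w assume "w \<in> closed_segment x z"
    then obtain t where t: "w = (1 - t) *\<^sub>R x + t *\<^sub>R z" "0 \<le> t" "t \<le> 1"
      unfolding closed_segment_def by blast
    show "w \<in> \<Omega>"
    proof (cases "t = 1")
      case True then show ?thesis using t that by simp
    next
      case False
      then have "w \<in> interior \<Omega>"
        using t that closure_subset[of \<Omega>] by (auto intro!: ray)
      then show ?thesis using interior_subset by blast
    qed
  qed
  have le\<epsilon>: "?B z \<le> ereal (L z)" if "z \<in> \<Omega> \<inter> cball y \<epsilon>" for z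
    using le seg\<Omega> that by blast
  have less: "usc_majorant \<Omega> f y < ereal (L y)"
  proof -
    have "f z \<le> ereal (L z)" if "z \<in> \<Omega> \<inter> ball y \<epsilon>" for z
      using le\<epsilon>[of z] min_locally_concave_ge[of z \<Omega> f] that by (auto intro: order_trans)
    then have "usc_majorant \<Omega> f y \<le> ereal (L y)"
      using usc_majorant_le_affine[OF affine_L \<epsilon>] by blast
    then show ?thesis using neq by (simp add: less_le)
  qed
  \<comment> \<open>Half of \<open>\<epsilon>\<close>, so that points of \<open>\<Omega>\<close> close to a point of \<open>cball y r\<close> are still covered by the cone condition.\<close>
  define r where "r = \<epsilon> / 2"
  have r: "r > 0" "r \<le> \<epsilon>" using \<epsilon> by (auto simp: r_def)

  have ray_contact: "?B ((1 - t) *\<^sub>R x + t *\<^sub>R z) = ereal (L ((1 - t) *\<^sub>R x + t *\<^sub>R z))"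
    if z: "z \<in> ?C \<inter> cball y r" and t: "0 \<le> t" "t < 1" for z t
  proof (rule antisym)
    let ?h = "(1 - t) *\<^sub>R x + t *\<^sub>R z"
    have zcl: "z \<in> cball y \<epsilon> \<inter> closure \<Omega>"
      using z r asymptotic_contact_subset_closure by fastforce
    have "closed_segment x w \<subseteq> \<Omega>" if "w \<in> \<Omega> \<inter> ball z r" for w
    proof (rule seg\<Omega>)
      have "dist y w \<le> dist y z + dist z w" by (rule dist_triangle)
      then show "w \<in> \<Omega> \<inter> cball y \<epsilon>" using that z by (auto simp: r_def)
    qed
    then have "?h \<in> ?C"
      using Bx z t r by (intro asymptotic_contact_homothety[OF lc affine_L, of x z r]) auto
    then show "ereal (L ?h) \<le> ?B ?h"
      using asymptotic_contact_interior[OF lc finite_B affine_L] ray[OF zcl t] by blast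
    have "closed_segment x ?h \<subseteq> \<Omega>"
    proof
      fix w assume "w \<in> closed_segment x ?h"
      then obtain s where s: "w = (1 - s) *\<^sub>R x + s *\<^sub>R ?h" "0 \<le> s" "s \<le> 1"
        unfolding closed_segment_def by blast
      have "s * t \<le> t" using s t by (simp add: mult_left_le_one_le)
      moreover have "w = (1 - s * t) *\<^sub>R x + (s * t) *\<^sub>R z"
        by (simp add: s algebra_simps)
      ultimately show "w \<in> \<Omega>"
        using ray[OF zcl, of "s * t"] s t interior_subset by auto
    qed
    then show "?B ?h \<le> ereal (L ?h)" by (rule le)
  qed

  \<comment> \<open>The ratio makes the homothety \<open>h\<close> with centre \<open>x\<close> map \<open>cball y \<epsilon>\<close> into \<open>ball x \<rho> \<subseteq> W\<close>.\<close>
  define \<tau> where "\<tau> = \<rho> / (\<rho> + (n + \<epsilon>))"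
  have \<tau>: "0 < \<tau>" "\<tau> < 1" using \<rho> n \<epsilon> by (auto simp: \<tau>_def)
  define h where "h = (\<lambda>z. (1 - \<tau>) *\<^sub>R x + \<tau> *\<^sub>R z)"
  have hW: "h z \<in> W" if "z \<in> cball y \<epsilon>" for z
  proof -
    have "norm (z - x) \<le> norm (z - y) + norm (y - x)"
      using norm_triangle_ineq[of "z - y" "y - x"] by simp
    then have "norm (z - x) \<le> n + \<epsilon>" using that by (simp add: n_def dist_norm norm_minus_commute)
    then have "\<tau> * norm (z - x) \<le> \<tau> * (n + \<epsilon>)" using \<tau> by simp
    also have "\<dots> < \<rho>"
    proof -
      have "\<rho> * (n + \<epsilon>) < \<rho> * (\<rho> + (n + \<epsilon>))" using \<rho> by simp
      then show ?thesis using \<rho> n \<epsilon> by (simp add: \<tau>_def pos_divide_less_eq)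
    qed
    finally have "\<tau> * norm (z - x) < \<rho>" .
    moreover have "x - h z = \<tau> *\<^sub>R (x - z)" by (simp add: h_def algebra_simps)
    ultimately have "dist x (h z) < \<rho>" using \<tau> by (simp add: dist_norm norm_minus_commute)
    then show ?thesis using \<rho>W by auto
  qed
  have h_range: "h (x + u *\<^sub>R (y - x)) = x + (\<tau> * u) *\<^sub>R (y - x)" for u
    by (simp add: h_def algebra_simps)
  have hl: "z \<in> l" if hz: "h z \<in> l" for z
  proof -
    obtain u where u: "h z = x + u *\<^sub>R (y - x)" using hz l_eq by blast
    have "\<tau> *\<^sub>R (z - x) = u *\<^sub>R (y - x)" using u by (simp add: h_def algebra_simps)
    then have "(1 / \<tau>) *\<^sub>R (\<tau> *\<^sub>R (z - x)) = (1 / \<tau>) *\<^sub>R (u *\<^sub>R (y - x))" by simp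
    then have "z - x = (u / \<tau>) *\<^sub>R (y - x)" using \<tau> by simp
    then have "z = x + (u / \<tau>) *\<^sub>R (y - x)" by (metis add.commute diff_add_cancel)
    then show ?thesis using l_eq by blast
  qed
  have lh: "h z \<in> l" if z: "z \<in> l" for z
  proof -
    obtain u where "z = x + u *\<^sub>R (y - x)" using z l_eq by blast
    then show ?thesis using h_range l_eq by auto
  qed

  \<comment> \<open>A contact point on \<open>l\<close> beyond \<open>y\<close> would make a small ball around \<open>y\<close> certify that \<open>y\<close> is pre-extremal.\<close>
  have not_beyond: "s \<le> 1" if z: "x + s *\<^sub>R (y - x) \<in> ?C \<inter> cball y r" for s
  proof (rule ccontr)
    assume "\<not> s \<le> 1"
    then have s: "s > 1" by simp
    let ?z = "x + s *\<^sub>R (y - x)"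
    have yz: "(1 - 1 / s) *\<^sub>R x + (1 / s) *\<^sub>R ?z = y" using s by (simp add: algebra_simps)
    have s1: "0 \<le> 1 / s" "1 / s < 1" using s by auto
    have "?z \<in> cball y \<epsilon> \<inter> closure \<Omega>"
      using z r asymptotic_contact_subset_closure by fastforce
    then have yI: "y \<in> interior \<Omega>" using ray[OF _ s1, of ?z] yz by simp
    have By: "?B y = ereal (L y)" using ray_contact[OF z s1] yz by simp
    obtain r0 where r0: "r0 > 0" "ball y r0 \<subseteq> E_pos \<Omega> f"
      using ball_subset_E_pos[OF finite_B yI] less By by metis
    define r' where "r' = min (r0 / 2) \<epsilon>"
    have r': "r' > 0" "r' \<le> \<epsilon>" using r0 \<epsilon> by (auto simp: r'_def)
    let ?W = "cball y r'"
    let ?V = "contact_set \<Omega> f ?W L"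
    have WE: "?W \<subseteq> E_pos \<Omega> f" using r0 by (auto simp: r'_def)
    then have WO: "?W \<subseteq> \<Omega>" using interior_subset[of \<Omega>] by (auto simp: E_pos_def)
    have leV: "?B z \<le> ereal (L z)" if "z \<in> ?W" for z
      using that WO r' by (intro le\<epsilon>) auto
    have cV: "convex ?V" using convex_contact_set[OF convex_cball WO affine_L leV] .
    have hV: "h q \<in> ?U" if q: "q \<in> ?V" for q
    proof -
      have qW: "q \<in> \<Omega> \<inter> cball y \<epsilon>" "?B q = ereal (L q)"
        using q WO r' by (auto simp: contact_set_def)
      have "ereal ((1 - \<tau>) * L x + \<tau> * L q) \<le> ?B (h q)"
        unfolding h_def using \<tau> Bx qW(2) by (intro locally_concave_onD[OF lc seg\<Omega>[OF qW(1)]]) auto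
      then have "ereal (L (h q)) \<le> ?B (h q)"
        unfolding h_def affine_functional_combination[OF affine_L] .
      moreover have "h q \<in> W" using qW hW by blast
      ultimately show ?thesis using leW by (simp add: contact_set_def antisym)
    qed
    have faceV: "(l \<inter> ?V) face_of ?V"
      unfolding face_of_def
    proof (intro conjI ballI impI)
      have "affine l" using line by (simp add: is_line_def)
      then show "convex (l \<inter> ?V)" using affine_imp_convex cV by (intro convex_Int) auto
    next
      fix a b c assume a: "a \<in> ?V" and b: "b \<in> ?V" and c: "c \<in> l \<inter> ?V" and cab: "c \<in> open_segment a b"
      obtain u where u: "a \<noteq> b" "0 < u" "u < 1" "c = (1 - u) *\<^sub>R a + u *\<^sub>R b"
        using cab by (auto simp: in_segment)
      have "h c = (1 - u) *\<^sub>R h a + u *\<^sub>R h b" by (simp add: h_def u(4) algebra_simps)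
      moreover have "h a \<noteq> h b" using u \<tau> by (simp add: h_def)
      ultimately have "h c \<in> open_segment (h a) (h b)" using u by (auto simp: in_segment)
      moreover have "h c \<in> l \<inter> ?U" using c lh hV by blast
      ultimately have "h a \<in> l" "h b \<in> l"
        using face hV[OF a] hV[OF b] unfolding face_of_def by blast+
      then show "a \<in> l \<inter> ?V" "b \<in> l \<inter> ?V" using a b hl by auto
    qed auto
    have yV: "y \<in> ?V" using By r' by (simp add: contact_set_def)
    \<comment> \<open>A second contact point, on the segment from \<open>x\<close> to \<open>y\<close>, makes the affine hull all of \<open>l\<close>.\<close>
    obtain p where p: "p \<in> l \<inter> ?V" "p \<noteq> y"
    proof
      define \<sigma> where "\<sigma> = r' / (r' + n)"
      have \<sigma>: "0 < \<sigma>" "\<sigma> < 1" "\<sigma> * n \<le> r'" using r' n by (auto simp: \<sigma>_def field_simps)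
      let ?p = "(1 - (1 - \<sigma>)) *\<^sub>R x + (1 - \<sigma>) *\<^sub>R y"
      have "?p \<in> ?P" using \<sigma> by (intro seg_E) auto
      moreover have yp: "y - ?p = \<sigma> *\<^sub>R (y - x)" by (simp add: algebra_simps)
      then have "dist y ?p \<le> r'" using \<sigma> by (simp add: dist_norm n_def)
      ultimately show "?p \<in> l \<inter> ?V" using P by (simp add: contact_set_def)
      show "?p \<noteq> y" using yp \<sigma> xy by auto
    qed
    have "affine hull {p, y} = l"
      using is_line_eq_range(1)[OF line _ yl p(2)] p by blast
    moreover have "affine hull {p, y} \<subseteq> affine hull (l \<inter> ?V)"
      using p yl yV by (intro hull_mono) auto
    moreover have "affine hull (l \<inter> ?V) \<subseteq> l"
      using line by (intro hull_minimal) (auto simp: is_line_def)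
    ultimately have "affine hull (l \<inter> ?V) = l" by blast
    moreover have "y \<in> interior ?W" using r' by simp
    ultimately have "y \<in> ?P"
      using WE leV yV faceV yl r' unfolding pre_extremal_set_def
      by (intro CollectI conjI exI[of _ ?W]) auto
    then show False using yP by blast
  qed

  have "y \<in> closure {z \<in> \<Omega>. ?B z = ereal (L z)}"
    using ycl closure_mono[of ?E "{z \<in> \<Omega>. ?B z = ereal (L z)}"] EP P interior_subset[of \<Omega>] by blast
  then obtain \<delta> where \<delta>: "\<delta> > 0" "y \<in> convex hull (?C \<inter> cball y r - ball y \<delta>)"
    using contact_point_in_convex_hull[OF affine_L less r(1), of thesis] le\<epsilon> r by force
  \<comment> \<open>The image of \<open>y\<close> under \<open>h\<close> lies in the hull of the images, which the face \<open>l \<inter> ?U\<close> forbids.\<close>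
  let ?A = "?C \<inter> cball y r - ball y \<delta>"
  have "compact (?C \<inter> cball y r)"
    using closed_asymptotic_contact by (intro closed_Int_compact) auto
  then have "compact ?A" by (intro compact_diff) auto
  then have "compact (h ` ?A)"
    unfolding h_def by (intro compact_continuous_image continuous_intros)
  moreover have "h ` ?A \<subseteq> ?U"
  proof
    fix w assume "w \<in> h ` ?A"
    then obtain z where z: "w = h z" "z \<in> ?C \<inter> cball y r" by blast
    have "h z \<in> W" using z r by (intro hW) auto
    then show "w \<in> ?U"
      using ray_contact[OF z(2), of \<tau>] \<tau> z(1) by (simp add: contact_set_def h_def)
  qed
  moreover have "h y \<in> l \<inter> ?U"
    using seg_E[of \<tau>] \<tau> P hW[of y] \<epsilon> by (auto simp: contact_set_def h_def)
  moreover have "(y - x) \<bullet> w < (y - x) \<bullet> h y" if w: "w \<in> h ` ?A \<inter> (l \<inter> ?U)" for w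
  proof -
    obtain z where z: "w = h z" "z \<in> ?A" using w by blast
    then have "z \<in> l" using w hl by blast
    then obtain s where s: "z = x + s *\<^sub>R (y - x)" using l_eq by blast
    have "s \<le> 1" using not_beyond[of s] z s by blast
    moreover have "s \<noteq> 1" using z s \<delta> by auto
    ultimately have "\<tau> * s < \<tau> * 1" using \<tau> by (intro mult_strict_left_mono) auto
    moreover have "(y - x) \<bullet> (y - x) > 0" using xy by simp
    ultimately have "(\<tau> * s) * ((y - x) \<bullet> (y - x)) < (\<tau> * 1) * ((y - x) \<bullet> (y - x))"
      by (rule mult_strict_right_mono)
    moreover have "w = x + (\<tau> * s) *\<^sub>R (y - x)" "h y = x + (\<tau> * 1) *\<^sub>R (y - x)"
      using z(1) s h_range[of s] h_range[of 1] by auto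
    ultimately show ?thesis by (simp add: inner_add_right)
  qed
  ultimately have "h y \<notin> convex hull (h ` ?A)"
    by (intro face_point_not_in_convex_hull[OF face cU])
  moreover have "h y \<in> convex hull (h ` ?A)"
    unfolding h_def convex_hull_affinity using \<delta>(2) by blast
  ultimately show False by blast
qed

end
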